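(* There is an algorithm that, given a connected $(2K_2, C_3, C_5)$-free graph $G$, finds a minimum feedback vertex set of $G$ in time linear in the input size.
   Context: Graphs are finite, simple and undirected. A graph is $(2K_2,C_3,C_5)$-free if it contains none of $2K_2$ (two disjoint edges with no edge between them), the triangle $C_3$, and the 5-cycle $C_5$ as an induced subgraph. A feedback vertex set of $G$ is a set $F\subseteq V(G)$ such that the subgraph induced on $V(G)\setminus F$ is a forest; it is minimum if it has smallest possible cardinality. *)

theory Defs
  imports Main
begin

section \<open>Finite simple undirected graphs\<close>

record 'a graph =
  verts :: "'a set"
  edges :: "'a set set"

definition simple_graph :: "'a graph \<Rightarrow> bool" where
  "simple_graph G \<longleftrightarrow> finite (verts G) \<and> (\<forall>e\<in>edges G. e \<subseteq> verts G \<and> card e = 2)"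

definition connected_graph :: "'a graph \<Rightarrow> bool" where
  "connected_graph G \<longleftrightarrow> verts G \<noteq> {} \<and>
     (\<forall>u\<in>verts G. \<forall>v\<in>verts G. (u, v) \<in> {(x, y). {x, y} \<in> edges G}\<^sup>*)"

definition induced_subgraph :: "'a graph \<Rightarrow> 'a set \<Rightarrow> 'a graph" where
  "induced_subgraph G S = \<lparr>verts = verts G \<inter> S, edges = {e \<in> edges G. e \<subseteq> S}\<rparr>"

definition graph_iso :: "'a graph \<Rightarrow> 'b graph \<Rightarrow> bool" where
  "graph_iso G H \<longleftrightarrow> (\<exists>f. bij_betw f (verts G) (verts H) \<and>
     (\<forall>u\<in>verts G. \<forall>v\<in>verts G. {u, v} \<in> edges G \<longleftrightarrow> {f u, f v} \<in> edges H))"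

definition induced_free :: "'b graph \<Rightarrow> 'a graph \<Rightarrow> bool" where
  "induced_free H G \<longleftrightarrow> \<not> (\<exists>S\<subseteq>verts G. graph_iso H (induced_subgraph G S))"

definition two_K2 :: "nat graph" where
  "two_K2 = \<lparr>verts = {0, 1, 2, 3}, edges = {{0, 1}, {2, 3}}\<rparr>"

definition cycle_graph :: "nat \<Rightarrow> nat graph" where
  "cycle_graph k = \<lparr>verts = {..<k}, edges = {{i, Suc i mod k} |i. i < k}\<rparr>"

definition is_cycle :: "'a graph \<Rightarrow> 'a list \<Rightarrow> bool" where
  "is_cycle G p \<longleftrightarrow> 3 \<le> length p \<and> distinct p \<and> set p \<subseteq> verts G \<and>
     (\<forall>i<length p. {p ! i, p ! (Suc i mod length p)} \<in> edges G)"

definition forest :: "'a graph \<Rightarrow> bool" where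
  "forest G \<longleftrightarrow> \<not> (\<exists>p. is_cycle G p)"

definition feedback_vertex_set :: "'a graph \<Rightarrow> 'a set \<Rightarrow> bool" where
  "feedback_vertex_set G F \<longleftrightarrow> F \<subseteq> verts G \<and> forest (induced_subgraph G (verts G - F))"

definition minimum_feedback_vertex_set :: "'a graph \<Rightarrow> 'a set \<Rightarrow> bool" where
  "minimum_feedback_vertex_set G F \<longleftrightarrow> feedback_vertex_set G F \<and>
     (\<forall>F'. feedback_vertex_set G F' \<longrightarrow> card F \<le> card F')"


section \<open>Random access machine\<close>

text \<open>
  The model is the random access machine of Cook and Reckhow, with structured control flow in place
  of jumps: one memory of cells addressed by natural numbers (the cells named by the program text
  serve as registers), indirect addressing, addition and truncated subtraction, a read-only
  sequential input and a write-only sequential output, and unit cost for every instruction and every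
  test. Because unit-cost addition is only reasonable on short words, the semantics takes the
  largest representable word \<open>W\<close>: an instruction producing a larger value has no execution.
  Reading past the end of the input has no execution either.
\<close>

datatype com =
    Skip
  | Const nat nat
  | Add nat nat nat
  | Sub nat nat nat
  | Load nat nat
  | Store nat nat
  | Read nat
  | Print nat
  | Seq com com
  | If nat com com
  | While nat com

record state =
  mem :: "nat \<Rightarrow> nat"
  inp :: "nat list"
  out :: "nat list"

text \<open>\<open>exec W c s t s'\<close>: with largest word \<open>W\<close>, program \<open>c\<close> started in \<open>s\<close> halts in \<open>s'\<close> after
  exactly \<open>t\<close> steps.\<close>

inductive exec :: "nat \<Rightarrow> com \<Rightarrow> state \<Rightarrow> nat \<Rightarrow> state \<Rightarrow> bool" for W :: nat where
  Skip: "exec W Skip s 1 s"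
| Const: "k \<le> W \<Longrightarrow> exec W (Const i k) s 1 (s\<lparr>mem := (mem s)(i := k)\<rparr>)"
| Add: "mem s j + mem s k \<le> W \<Longrightarrow>
    exec W (Add i j k) s 1 (s\<lparr>mem := (mem s)(i := mem s j + mem s k)\<rparr>)"
| Sub: "exec W (Sub i j k) s 1 (s\<lparr>mem := (mem s)(i := mem s j - mem s k)\<rparr>)"
| Load: "exec W (Load i j) s 1 (s\<lparr>mem := (mem s)(i := mem s (mem s j))\<rparr>)"
| Store: "exec W (Store i j) s 1 (s\<lparr>mem := (mem s)(mem s i := mem s j)\<rparr>)"
| Read: "inp s = x # xs \<Longrightarrow> x \<le> W \<Longrightarrow>
    exec W (Read i) s 1 (s\<lparr>mem := (mem s)(i := x), inp := xs\<rparr>)"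
| Print: "exec W (Print i) s 1 (s\<lparr>out := out s @ [mem s i]\<rparr>)"
| Seq: "exec W c1 s t1 s1 \<Longrightarrow> exec W c2 s1 t2 s2 \<Longrightarrow> exec W (Seq c1 c2) s (t1 + t2) s2"
| IfTrue: "mem s i > 0 \<Longrightarrow> exec W c1 s t s' \<Longrightarrow> exec W (If i c1 c2) s (1 + t) s'"
| IfFalse: "mem s i = 0 \<Longrightarrow> exec W c2 s t s' \<Longrightarrow> exec W (If i c1 c2) s (1 + t) s'"
| WhileFalse: "mem s i = 0 \<Longrightarrow> exec W (While i c) s 1 s"
| WhileTrue: "mem s i > 0 \<Longrightarrow> exec W c s t1 s1 \<Longrightarrow> exec W (While i c) s1 t2 s2 \<Longrightarrow>
    exec W (While i c) s (1 + t1 + t2) s2"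

definition initial_state :: "nat list \<Rightarrow> state" where
  "initial_state xs = \<lparr>mem = (\<lambda>_. 0), inp = xs, out = []\<rparr>"


section \<open>Graphs as inputs\<close>

text \<open>
  A graph on the vertices \<open>0, \<dots>, n - 1\<close> with \<open>m\<close> edges is presented as
  \<open>n, m, u\<^sub>1, v\<^sub>1, \<dots>, u\<^sub>m, v\<^sub>m\<close>, where each edge is listed exactly once. The order of
  the edges and of the two endpoints is arbitrary, so a graph has many encodings.
\<close>

definition encodes :: "nat list \<Rightarrow> nat graph \<Rightarrow> bool" where
  "encodes xs G \<longleftrightarrow> (\<exists>n es. verts G = {..<n} \<and>
     distinct (map (\<lambda>(u, v). {u, v}) es) \<and> edges G = set (map (\<lambda>(u, v). {u, v}) es) \<and>
     xs = n # length es # concat (map (\<lambda>(u, v). [u, v]) es))"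

definition input_size :: "nat graph \<Rightarrow> nat" where
  "input_size G = card (verts G) + card (edges G)"

text \<open>
  \<open>P\<close> solves, in linear time, the problem of finding for each instance \<open>G\<close> with \<open>I G\<close> a vertex set
  \<open>F\<close> with \<open>S G F\<close>; the set is printed without repetitions. The bound on words, polynomial in
  the input size, amounts to a word length of \<open>O(log (input_size G))\<close> bits.
\<close>

definition solves_in_linear_time ::
    "com \<Rightarrow> (nat graph \<Rightarrow> bool) \<Rightarrow> (nat graph \<Rightarrow> nat set \<Rightarrow> bool) \<Rightarrow> bool" where
  "solves_in_linear_time P I S \<longleftrightarrow> (\<exists>c d. \<forall>G xs. I G \<longrightarrow> encodes xs G \<longrightarrow>
     (\<exists>t s. exec ((input_size G + 1) ^ d) P (initial_state xs) t s \<and> t \<le> c * input_size G \<and>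
        distinct (out s) \<and> S G (set (out s))))"

end

theory Submission
  imports Defs
begin

text \<open>
  Let \<open>v\<close> be a vertex of maximum degree, \<open>N(v)\<close> its set of neighbours and \<open>A = V - N(v)\<close>.
  \<open>N(v)\<close> is independent because there is no triangle. \<open>A\<close> is independent as well: an edge \<open>uw\<close>
  inside \<open>A\<close> is not separated from any edge at \<open>v\<close>, so each vertex of \<open>N(v)\<close> is adjacent to \<open>u\<close> or
  \<open>w\<close>, and then either a 5-cycle appears or one of \<open>u\<close>, \<open>w\<close> has larger degree than \<open>v\<close>
  (\<open>A_independent\<close>). Since there is no \<open>2K\<^sub>2\<close>, the neighbourhoods of the vertices of \<open>A\<close> are
  linearly ordered by inclusion, that is, by degree (\<open>nested\<close>): the graph is a chain graph.

  A set \<open>F\<close> leaves a forest iff no two vertices of \<open>A - F\<close> have two common neighbours outside \<open>F\<close>.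
  Because the neighbourhoods are nested, only the vertex \<open>y\<close> of second largest degree in \<open>A - F\<close>
  matters: all but one of its neighbours lie in \<open>F\<close>, and so do all but one of the vertices of \<open>A\<close>
  of degree larger than \<open>deg y\<close>; the exception may as well be \<open>v\<close>. Hence the minimum size is the
  minimum over \<open>d \<ge> 1\<close> of
    \<open>card {u \<in> A - {v}. d < deg u} + (d - 1)\<close>,
  and for an optimal \<open>d\<close> it is attained by that set together with all but one of the neighbours of a
  vertex \<open>y \<in> A - {v}\<close> of largest degree \<open>\<le> d\<close> (\<open>feedback_vertex_set_lower\<close>,
  \<open>feedback_vertex_set_above\<close>).

  Everything in this description can be found by a constant number of passes over the vertices and
  over the edge list. The degrees are counted while reading the input; a pass over the vertices
  finds \<open>v\<close>; a pass over the edges overwrites by \<open>0\<close> the degrees of the neighbours of \<open>v\<close>, and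
  that of \<open>v\<close> is overwritten too; the remaining degrees are tabulated in \<open>n + 1\<close> counters, from which one sweep over \<open>d\<close> finds an
  optimal threshold; the last two passes print the two parts of the solution. No adjacency lists,
  searches or sorting are needed, so each pass is a loop with a loop-free body, and its correctness
  is a single invariant.
\<close>

section \<open>Forbidden induced subgraphs\<close>

definition nb :: "'a graph \<Rightarrow> 'a \<Rightarrow> 'a set" where
  "nb G u = {w. {u, w} \<in> edges G}"

lemma nb_sym: "w \<in> nb G u \<longleftrightarrow> u \<in> nb G w"
  by (simp add: nb_def insert_commute)

lemma nb_verts: "simple_graph G \<Longrightarrow> w \<in> nb G u \<Longrightarrow> u \<in> verts G \<and> w \<in> verts G \<and> u \<noteq> w"
  by (auto simp: nb_def simple_graph_def)

lemma finite_nb: "simple_graph G \<Longrightarrow> finite (nb G u)"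
  using nb_verts finite_subset[of "nb G u" "verts G"] by (metis simple_graph_def subsetI)

lemma no_loop: "simple_graph G \<Longrightarrow> {a} \<notin> edges G"
  by (auto simp: simple_graph_def)

lemma no_two_K2:
  assumes "simple_graph G" "induced_free two_K2 G"
    and "b \<in> nb G a" "d \<in> nb G c"
    and "c \<notin> nb G a" "d \<notin> nb G a" "c \<notin> nb G b" "d \<notin> nb G b"
  shows False
proof -
  have V: "a \<in> verts G" "b \<in> verts G" "c \<in> verts G" "d \<in> verts G" and ne: "a \<noteq> b" "c \<noteq> d"
    using assms nb_verts by metis+
  have ne': "a \<noteq> c" "a \<noteq> d" "b \<noteq> c" "b \<noteq> d"
    using assms nb_sym by metis+
  note E = assms(3-8)[unfolded nb_def mem_Collect_eq]
  define f where "f i = (if i = 0 then a else if i = 1 then b else if i = 2 then c else d)" for i :: nat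
  have "graph_iso two_K2 (induced_subgraph G {a, b, c, d})"
    unfolding graph_iso_def
  proof (intro exI[of _ f] conjI)
    show "bij_betw f (verts two_K2) (verts (induced_subgraph G {a, b, c, d}))"
      using V ne ne' by (auto simp: bij_betw_def inj_on_def f_def two_K2_def induced_subgraph_def)
    show "\<forall>u\<in>verts two_K2. \<forall>v\<in>verts two_K2.
        {u, v} \<in> edges two_K2 \<longleftrightarrow> {f u, f v} \<in> edges (induced_subgraph G {a, b, c, d})"
      using E no_loop[OF assms(1)]
      by (simp add: two_K2_def f_def induced_subgraph_def doubleton_eq_iff insert_commute)
  qed
  then show False
    using assms(2) V by (auto simp: induced_free_def)
qed

lemma no_C3:
  assumes "simple_graph G" "induced_free (cycle_graph 3) G"
    and "b \<in> nb G a" "c \<in> nb G b" "a \<in> nb G c"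
  shows False
proof -
  have V: "a \<in> verts G" "b \<in> verts G" "c \<in> verts G" and ne: "a \<noteq> b" "b \<noteq> c" "c \<noteq> a"
    using assms nb_verts by metis+
  note E = assms(3-5)[unfolded nb_def mem_Collect_eq]
  define f where "f i = (if i = 0 then a else if i = 1 then b else c)" for i :: nat
  have less: "{i::nat. i < 3} = {0, 1, 2}" "{..<3} = {0, 1, 2::nat}"
    by auto
  have C: "verts (cycle_graph 3) = {0, 1, 2}" "edges (cycle_graph 3) = {{0, 1}, {1, 2}, {2, 0}}"
    unfolding cycle_graph_def graph.simps setcompr_eq_image less by (simp_all add: numeral_2_eq_2)
  have "graph_iso (cycle_graph 3) (induced_subgraph G {a, b, c})"
    unfolding graph_iso_def
  proof (intro exI[of _ f] conjI)
    show "bij_betw f (verts (cycle_graph 3)) (verts (induced_subgraph G {a, b, c}))"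
      using V ne by (auto simp: C bij_betw_def inj_on_def f_def induced_subgraph_def)
    show "\<forall>u\<in>verts (cycle_graph 3). \<forall>v\<in>verts (cycle_graph 3). {u, v} \<in> edges (cycle_graph 3)
        \<longleftrightarrow> {f u, f v} \<in> edges (induced_subgraph G {a, b, c})"
      using E no_loop[OF assms(1)]
      by (simp add: C f_def induced_subgraph_def doubleton_eq_iff insert_commute)
  qed
  then show False
    using assms(2) V by (auto simp: induced_free_def)
qed

lemma no_C5:
  assumes "simple_graph G" "induced_free (cycle_graph 5) G"
    and "b \<in> nb G a" "c \<in> nb G b" "d \<in> nb G c" "e \<in> nb G d" "a \<in> nb G e"
    and "c \<notin> nb G a" "d \<notin> nb G b" "e \<notin> nb G c" "a \<notin> nb G d" "b \<notin> nb G e"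
  shows False
proof -
  have V: "a \<in> verts G" "b \<in> verts G" "c \<in> verts G" "d \<in> verts G" "e \<in> verts G"
    and ne: "a \<noteq> b" "b \<noteq> c" "c \<noteq> d" "d \<noteq> e" "e \<noteq> a"
    using assms nb_verts by metis+
  have ne': "a \<noteq> c" "b \<noteq> d" "c \<noteq> e" "d \<noteq> a" "e \<noteq> b"
    using assms nb_sym by metis+
  note E = assms(3-12)[unfolded nb_def mem_Collect_eq]
  define f where "f i = (if i = 0 then a else if i = 1 then b else if i = 2 then c
    else if i = 3 then d else e)" for i :: nat
  have less: "{i::nat. i < 5} = {0, 1, 2, 3, 4}" "{..<5} = {0, 1, 2, 3, 4::nat}"
    by auto
  have C: "verts (cycle_graph 5) = {0, 1, 2, 3, 4}"
    "edges (cycle_graph 5) = {{0, 1}, {1, 2}, {2, 3}, {3, 4}, {4, 0}}"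
    unfolding cycle_graph_def graph.simps setcompr_eq_image less by (simp_all add: numeral_2_eq_2)
  have "graph_iso (cycle_graph 5) (induced_subgraph G {a, b, c, d, e})"
    unfolding graph_iso_def
  proof (intro exI[of _ f] conjI)
    show "bij_betw f (verts (cycle_graph 5)) (verts (induced_subgraph G {a, b, c, d, e}))"
      using V ne ne' by (auto simp: C bij_betw_def inj_on_def f_def induced_subgraph_def)
    show "\<forall>u\<in>verts (cycle_graph 5). \<forall>v\<in>verts (cycle_graph 5). {u, v} \<in> edges (cycle_graph 5)
        \<longleftrightarrow> {f u, f v} \<in> edges (induced_subgraph G {a, b, c, d, e})"
      using E no_loop[OF assms(1)]
      by (simp add: C f_def induced_subgraph_def doubleton_eq_iff insert_commute)
  qed
  then show False
    using assms(2) V by (auto simp: induced_free_def)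
qed

section \<open>Feedback vertex sets of chain graphs\<close>

lemma exists_max:
  fixes f :: "'a \<Rightarrow> nat"
  assumes "finite S" "S \<noteq> {}"
  shows "\<exists>x\<in>S. \<forall>u\<in>S. f u \<le> f x"
  using assms by (metis Max_ge finite_imageI image_eqI obtains_MAX)

locale chain_graph =
  fixes G :: "'a graph" and v :: 'a
  assumes simple: "simple_graph G"
    and two_K2_free: "induced_free two_K2 G"
    and C3_free: "induced_free (cycle_graph 3) G"
    and C5_free: "induced_free (cycle_graph 5) G"
    and v_verts: "v \<in> verts G"
    and v_max: "u \<in> verts G \<Longrightarrow> card (nb G u) \<le> card (nb G v)"
begin

definition A :: "'a set" where
  "A = verts G - nb G v"

lemma finite_A: "finite A"
  using simple by (simp add: A_def simple_graph_def)

lemma v_in_A: "v \<in> A"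
  using v_verts nb_verts[OF simple] by (auto simp: A_def)

lemma nb_v_independent: "b \<in> nb G v \<Longrightarrow> b' \<in> nb G v \<Longrightarrow> b' \<notin> nb G b"
  using no_C3[OF simple C3_free, of b v b'] nb_sym[of v G b'] by blast

text \<open>Otherwise the degree of \<open>u\<close> would exceed that of \<open>v\<close>.\<close>

lemma not_adjacent_to_all:
  assumes "w \<in> nb G u" "w \<notin> nb G v"
  shows "\<not> nb G v \<subseteq> nb G u"
proof
  assume "nb G v \<subseteq> nb G u"
  then have "nb G v \<subset> nb G u"
    using assms by blast
  then have "card (nb G v) < card (nb G u)"
    by (rule psubset_card_mono[OF finite_nb[OF simple]])
  moreover have "u \<in> verts G"
    using assms nb_verts[OF simple] by blast
  ultimately show False
    using v_max[of u] by simp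
qed

text \<open>Given an edge \<open>uw\<close> inside \<open>A\<close>, every neighbour of \<open>v\<close> is adjacent to \<open>u\<close> or \<open>w\<close> by
  \<open>2K\<^sub>2\<close>-freeness, but neither \<open>u\<close> nor \<open>w\<close> is adjacent to all of them. This gives the 5-cycle
  \<open>v, c, u, w, b\<close>.\<close>

lemma A_independent:
  assumes "u \<in> A" "w \<in> A"
  shows "w \<notin> nb G u"
proof
  assume uw: "w \<in> nb G u"
  have n: "u \<notin> nb G v" "w \<notin> nb G v"
    using assms by (auto simp: A_def)
  have alt: "b \<in> nb G u \<or> b \<in> nb G w" if "b \<in> nb G v" for b
    using no_two_K2[OF simple two_K2_free that uw] n nb_sym[of u G b] nb_sym[of w G b]
    by blast
  obtain b where b: "b \<in> nb G v" "b \<notin> nb G u" "b \<in> nb G w"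
    using not_adjacent_to_all[OF uw n(2)] alt by blast
  obtain c where c: "c \<in> nb G v" "c \<notin> nb G w" "c \<in> nb G u"
    using not_adjacent_to_all[of u w] uw nb_sym[of w G u] n(1) alt by blast
  show False
  proof (rule no_C5[OF simple C5_free])
    show "c \<in> nb G v" "u \<in> nb G c" "w \<in> nb G u" "b \<in> nb G w" "v \<in> nb G b"
      using b(1,3) c(1,3) uw by (simp_all only: nb_sym[of u G c] nb_sym[of v G b])
    show "u \<notin> nb G v" "w \<notin> nb G c" "b \<notin> nb G u" "v \<notin> nb G w" "c \<notin> nb G b"
      using b(2) c(2) n nb_v_independent[OF b(1) c(1)]
      by (simp_all only: nb_sym[of w G c] nb_sym[of v G w] not_False_eq_True)
  qed
qed

lemma nb_A:
  assumes "u \<in> A"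
  shows "nb G u \<subseteq> nb G v"
proof
  fix w assume "w \<in> nb G u"
  moreover from this have "w \<notin> A" "w \<in> verts G"
    using A_independent[OF assms, of w] nb_verts[OF simple, of w u] by blast+
  ultimately show "w \<in> nb G v"
    by (simp add: A_def)
qed

text \<open>Neighbours \<open>b\<close>, \<open>c\<close> that witness incomparable neighbourhoods give the induced \<open>2K\<^sub>2\<close> formed by
  \<open>ub\<close> and \<open>wc\<close>; comparable neighbourhoods are ordered by their size.\<close>

lemma nested:
  assumes "u \<in> A" "w \<in> A" "card (nb G u) \<le> card (nb G w)"
  shows "nb G u \<subseteq> nb G w"
proof (rule ccontr)
  assume "\<not> nb G u \<subseteq> nb G w"
  then obtain b where b: "b \<in> nb G u" "b \<notin> nb G w"
    by blast
  have "\<not> nb G w \<subseteq> nb G u"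
  proof
    assume "nb G w \<subseteq> nb G u"
    then have "nb G w \<subset> nb G u"
      using b by blast
    from psubset_card_mono[OF finite_nb[OF simple] this] show False
      using assms(3) by simp
  qed
  then obtain c where c: "c \<in> nb G w" "c \<notin> nb G u"
    by blast
  have "c \<notin> nb G b"
    using nb_v_independent[of b c] nb_A[OF assms(1)] nb_A[OF assms(2)] b(1) c(1) by blast
  then show False
    using no_two_K2[OF simple two_K2_free b(1) c(1)] A_independent[OF assms(1,2)] b(2) c(2)
      nb_sym[of b G w] by blast
qed

text \<open>The degree on \<open>A - {v}\<close>, with default \<open>0\<close> on \<open>v\<close> and its neighbours. The default lets the
  program store the set \<open>A - {v}\<close> implicitly: since only levels above a threshold \<open>d \<ge> 1\<close> and positive
  levels up to it are looked for, the excluded vertices (and isolated ones) are never selected.\<close>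

definition level :: "'a \<Rightarrow> nat" where
  "level u = (if u = v \<or> u \<in> nb G v then 0 else card (nb G u))"

abbreviation above :: "nat \<Rightarrow> 'a set" where
  "above d \<equiv> {u \<in> verts G. d < level u}"

lemma above_eq: "above d = {u \<in> A - {v}. d < card (nb G u)}"
  by (auto simp: level_def A_def)

text \<open>After the removal, each vertex of \<open>A - {v}\<close> has \<open>z\<close> as its only possible neighbour, by nesting
  of its neighbourhood in that of \<open>y\<close>. A cycle would visit \<open>A\<close> only in \<open>v\<close>, yet each of its edges
  has an end in \<open>A\<close>.\<close>

lemma feedback_vertex_set_above:
  assumes F: "F \<subseteq> verts G" "above d \<subseteq> F"
    and y: "\<And>u. u \<in> verts G \<Longrightarrow> 0 < level u \<Longrightarrow> level u \<le> d \<Longrightarrow> y \<in> A \<and> level u \<le> card (nb G y)"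
    and z: "nb G y \<subseteq> insert z F"
  shows "feedback_vertex_set G F"
proof -
  let ?H = "induced_subgraph G (verts G - F)"
  have one: "w = z" if u: "u \<in> A" "u \<noteq> v" "u \<notin> F" and w: "w \<in> nb G u" "w \<notin> F" for u w
  proof -
    have uV: "u \<in> verts G" "u \<notin> nb G v"
      using u by (auto simp: A_def)
    have lev: "level u = card (nb G u)"
      using u uV by (simp add: level_def)
    have "0 < level u"
      using w finite_nb[OF simple, of u] unfolding lev by (auto simp: card_gt_0_iff)
    moreover have "level u \<le> d"
      using u uV F(2) by fastforce
    ultimately have "y \<in> A" "card (nb G u) \<le> card (nb G y)"
      using y[OF uV(1)] lev by auto
    then have "nb G u \<subseteq> nb G y"
      using nested u(1) by blast
    then show ?thesis
      using z w by blast
  qed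
  have "\<not> is_cycle ?H p" for p
  proof
    assume p: "is_cycle ?H p"
    let ?l = "length p"
    have l: "3 \<le> ?l" and dp: "distinct p" and Vp: "set p \<subseteq> verts G - F"
      using p by (auto simp: is_cycle_def induced_subgraph_def)
    have step: "p ! (Suc i mod ?l) \<in> nb G (p ! i)" if "i < ?l" for i
      using p that by (auto simp: is_cycle_def induced_subgraph_def nb_def)
    have on_A: "p ! i = v" if i: "i < ?l" "p ! i \<in> A" for i
    proof (rule ccontr)
      assume ne: "p ! i \<noteq> v"
      \<comment> \<open>\<open>j\<close> and \<open>k\<close> are the cyclic predecessor and successor of \<open>i\<close>.\<close>
      define j where "j = (if i = 0 then ?l - 1 else i - 1)"
      have j: "j < ?l" "Suc j mod ?l = i"
        using i(1) l by (auto simp: j_def)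
      define k where "k = Suc i mod ?l"
      have k: "k < ?l" "k \<noteq> j"
        using i(1) l by (auto simp: j_def k_def mod_Suc split: if_splits)
      have "p ! k \<in> nb G (p ! i)" "p ! j \<in> nb G (p ! i)"
        using step[OF i(1)] step[OF j(1)] j(2) nb_sym unfolding k_def by metis+
      moreover have "p ! i \<notin> F" "p ! j \<notin> F" "p ! k \<notin> F"
        using Vp i(1) j(1) k(1) by (meson DiffD2 nth_mem subsetD)+
      ultimately have "p ! k = p ! j"
        using one[OF i(2) ne] by metis
      then show False
        using dp j(1) k by (simp add: nth_eq_iff_index_eq)
    qed
    have edge: "p ! i = v \<or> p ! (Suc i mod ?l) = v" if i: "i < ?l" for i
    proof -
      have "Suc i mod ?l < ?l"
        using i by (intro mod_less_divisor) linarith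
      moreover have "p ! i \<in> verts G" "p ! (Suc i mod ?l) \<in> verts G"
        using Vp i calculation by (meson DiffD1 nth_mem subsetD)+
      ultimately show ?thesis
        using on_A i step[OF i] nb_v_independent by (metis A_def DiffI)
    qed
    have eq: "p ! i = p ! j \<longleftrightarrow> i = j" if "i < ?l" "j < ?l" for i j
      using dp that by (simp add: nth_eq_iff_index_eq)
    have pne: "p \<noteq> []"
      using l by auto
    \<comment> \<open>Three consecutive edges cannot all contain \<open>v\<close>.\<close>
    have "p ! 0 = v \<or> p ! 1 = v" "p ! 1 = v \<or> p ! 2 = v"
      using edge[of 0] edge[of 1] l pne by (simp_all add: numeral_2_eq_2)
    then have "p ! 1 = v"
      using eq[of 0 2] l pne by auto
    moreover have "p ! 2 = v \<or> p ! (3 mod ?l) = v"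
      using edge[of 2] l pne by (auto simp: numeral_2_eq_2 numeral_3_eq_3)
    moreover have "3 mod ?l \<noteq> 1" "3 mod ?l < ?l"
      using l by (cases "?l = 3"; simp)+
    ultimately show False
      using eq[of 1 2] eq[of 1 "3 mod ?l"] l pne by auto
  qed
  then show ?thesis
    using F(1) by (auto simp: feedback_vertex_set_def forest_def)
qed

lemma common_neighbours:
  assumes F: "feedback_vertex_set G F"
    and xy: "x \<in> A - F" "y \<in> A - F" "x \<noteq> y"
    and bc: "b \<in> nb G x - F" "b \<in> nb G y" "c \<in> nb G x - F" "c \<in> nb G y"
  shows "b = c"
proof (rule ccontr)
  assume ne: "b \<noteq> c"
  have "b \<in> verts G" "c \<in> verts G" "x \<in> verts G" "y \<in> verts G"
    using bc nb_verts[OF simple] by blast+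
  moreover have "b \<noteq> x" "b \<noteq> y" "c \<noteq> x" "c \<noteq> y"
    using bc nb_verts[OF simple] by blast+
  ultimately have "is_cycle (induced_subgraph G (verts G - F)) [x, b, y, c]"
    using ne xy bc
    by (auto simp: is_cycle_def induced_subgraph_def nb_def less_Suc_eq insert_commute)
  then show False
    using F by (auto simp: feedback_vertex_set_def forest_def)
qed

text \<open>The threshold is the degree of a vertex \<open>y\<close> of second largest degree in \<open>A - F\<close>, or \<open>1\<close> if that
  degree is \<open>0\<close> or \<open>A - F\<close> has at most one element. The neighbours of \<open>y\<close> are common neighbours of \<open>y\<close> and the surviving
  vertex \<open>x\<close> of largest degree, so all but one of them lie in \<open>F\<close>; apart from \<open>x\<close>, every vertex of
  \<open>A\<close> of larger degree than \<open>y\<close> lies in \<open>F\<close> too.\<close>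

lemma feedback_vertex_set_lower:
  assumes F: "feedback_vertex_set G F"
  shows "\<exists>d. 1 \<le> d \<and> d \<le> card (verts G) \<and> card (above d) + d \<le> card F + 1"
proof -
  have FV: "F \<subseteq> verts G" and finV: "finite (verts G)"
    using F simple by (auto simp: feedback_vertex_set_def simple_graph_def)
  have finF: "finite F"
    using FV finV finite_subset by blast
  have V1: "1 \<le> card (verts G)"
    using v_verts finV by (metis One_nat_def Suc_leI card_gt_0_iff empty_iff)
  let ?deg = "\<lambda>u. card (nb G u)"
  show ?thesis
  proof (cases "\<exists>x y. x \<in> A - F \<and> y \<in> A - F \<and> x \<noteq> y")
    case False
    have "card (A - F) \<le> 1"
      using False card_le_Suc0_iff_eq[of "A - F"] finite_A by auto
    then have "card A \<le> card (F \<inter> A) + 1"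
      using card_Diff_subset_Int[of A F] finite_A by (simp add: Int_commute)
    moreover have "card (F \<inter> A) \<le> card F"
      by (rule card_mono[OF finF]) simp
    moreover have "card (above 1) \<le> card (A - {v})"
      unfolding above_eq by (rule card_mono) (auto simp: finite_A)
    moreover have "card (A - {v}) + 1 = card A"
      using v_in_A finite_A by (metis Suc_eq_plus1 card_Suc_Diff1)
    ultimately show ?thesis
      using V1 by (intro exI[of _ 1]) simp
  next
    case True
    have fin: "finite (A - F)"
      using finite_A by simp
    obtain x where x: "x \<in> A - F" "\<And>u. u \<in> A - F \<Longrightarrow> ?deg u \<le> ?deg x"
      using exists_max[OF fin, of ?deg] True by blast
    have "\<exists>y\<in>A - F - {x}. \<forall>u\<in>A - F - {x}. ?deg u \<le> ?deg y"
      by (rule exists_max) (use fin True in auto)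
    then obtain y where y: "y \<in> A - F - {x}" "\<And>u. u \<in> A - F - {x} \<Longrightarrow> ?deg u \<le> ?deg y"
      by blast
    have sub: "nb G y \<subseteq> nb G x"
      using nested x y by blast
    have "card (nb G y - F) \<le> 1"
      using card_le_Suc0_iff_eq[of "nb G y - F"] finite_nb[OF simple]
        common_neighbours[OF F, of x y] x(1) y(1) sub by auto
    then have degy: "?deg y \<le> card (F \<inter> nb G y) + 1"
      using card_Diff_subset_Int[of "nb G y" F] finite_nb[OF simple, of y] by (simp add: Int_commute)
    have disj: "(F \<inter> A) \<inter> (F \<inter> nb G y) = {}"
      using nb_A y(1) by (auto simp: A_def)
    have split: "card (F \<inter> A) + card (F \<inter> nb G y) \<le> card F"
      using card_Un_disjoint[of "F \<inter> A" "F \<inter> nb G y", OF _ _ disj] finF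
        card_mono[OF finF, of "(F \<inter> A) \<union> (F \<inter> nb G y)"] by auto
    have "card (above (?deg y)) \<le> card (F \<inter> A)"
    proof (cases "?deg y < ?deg v")
      case True
      \<comment> \<open>The survivor of largest degree is exchanged for \<open>v\<close>.\<close>
      have "insert v (above (?deg y)) \<subseteq> insert x (F \<inter> A)"
        using y(2) True v_in_A unfolding above_eq by fastforce
      then have "card (insert v (above (?deg y))) \<le> card (insert x (F \<inter> A))"
        by (rule card_mono[rotated]) (use finF in simp)
      moreover have "v \<notin> above (?deg y)" "finite (above (?deg y))" "x \<notin> F"
        using finV x(1) by (auto simp: level_def)
      ultimately show ?thesis
        using finF by simp
    next
      case False
      then have "above (?deg y) = {}"
        using v_max unfolding above_eq by (fastforce simp: A_def)
      then show ?thesis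
        by (metis card.empty le0)
    qed
    moreover have "card (above (max 1 (?deg y))) \<le> card (above (?deg y))"
      by (rule card_mono) (use finV in auto)
    moreover have "max 1 (?deg y) \<le> card (verts G)"
      using V1 card_mono[OF finV, of "nb G y"] nb_verts[OF simple] by auto
    ultimately show ?thesis
      using degy split by (intro exI[of _ "max 1 (?deg y)"]) auto
  qed
qed

text \<open>The form in which the output of the program is judged. When no vertex of \<open>A - {v}\<close> has a degree
  between \<open>1\<close> and \<open>d\<close>, any \<open>y\<close> without neighbours will do.\<close>

lemma minimum_feedback_vertex_set_above:
  assumes F: "F \<subseteq> verts G" "above d \<subseteq> F"
    and y: "\<And>u. u \<in> verts G \<Longrightarrow> 0 < level u \<Longrightarrow> level u \<le> d \<Longrightarrow> y \<in> A \<and> level u \<le> card (nb G y)"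
    and z: "nb G y \<subseteq> insert z F"
    and card: "card F + 1 \<le> card (above d) + d"
    and d: "\<And>d'. 1 \<le> d' \<Longrightarrow> d' \<le> card (verts G) \<Longrightarrow> card (above d) + d \<le> card (above d') + d'"
  shows "minimum_feedback_vertex_set G F"
  unfolding minimum_feedback_vertex_set_def
proof (intro conjI allI impI)
  show "feedback_vertex_set G F"
    by (rule feedback_vertex_set_above[OF F y z])
  fix F' assume "feedback_vertex_set G F'"
  from feedback_vertex_set_lower[OF this] d card show "card F \<le> card F'"
    by fastforce
qed

end

section \<open>Verification of programs with simple loops\<close>

text \<open>Weakest preconditions for loop-free programs, written so that the simplifier can execute a loop
  body symbolically. The running time is bounded separately and syntactically by \<open>cost\<close>. Loops are
  dealt with by \<open>reaches_While\<close>, hence the precondition \<open>False\<close>.\<close>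

fun wp :: "nat \<Rightarrow> com \<Rightarrow> (state \<Rightarrow> bool) \<Rightarrow> state \<Rightarrow> bool" where
  "wp W Skip Q s = Q s"
| "wp W (Const i k) Q s = (k \<le> W \<and> Q (s\<lparr>mem := (mem s)(i := k)\<rparr>))"
| "wp W (Add i j k) Q s =
    (mem s j + mem s k \<le> W \<and> Q (s\<lparr>mem := (mem s)(i := mem s j + mem s k)\<rparr>))"
| "wp W (Sub i j k) Q s = Q (s\<lparr>mem := (mem s)(i := mem s j - mem s k)\<rparr>)"
| "wp W (Load i j) Q s = Q (s\<lparr>mem := (mem s)(i := mem s (mem s j))\<rparr>)"
| "wp W (Store i j) Q s = Q (s\<lparr>mem := (mem s)(mem s i := mem s j)\<rparr>)"
| "wp W (Read i) Q s = (inp s \<noteq> [] \<and> hd (inp s) \<le> W \<and>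
    Q (s\<lparr>mem := (mem s)(i := hd (inp s)), inp := tl (inp s)\<rparr>))"
| "wp W (Print i) Q s = Q (s\<lparr>out := out s @ [mem s i]\<rparr>)"
| "wp W (Seq c1 c2) Q s = wp W c1 (wp W c2 Q) s"
| "wp W (If i c1 c2) Q s = (if mem s i > 0 then wp W c1 Q s else wp W c2 Q s)"
| "wp W (While i c) Q s = False"

fun cost :: "com \<Rightarrow> nat" where
  "cost (Seq c1 c2) = cost c1 + cost c2"
| "cost (If i c1 c2) = 1 + max (cost c1) (cost c2)"
| "cost c = 1"

definition reaches :: "nat \<Rightarrow> com \<Rightarrow> nat \<Rightarrow> (state \<Rightarrow> bool) \<Rightarrow> state \<Rightarrow> bool" where
  "reaches W c T Q s \<longleftrightarrow> (\<exists>t s'. exec W c s t s' \<and> t \<le> T \<and> Q s')"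

lemma reaches_wp: "wp W c Q s \<Longrightarrow> reaches W c (cost c) Q s"
proof (induction c arbitrary: Q s)
  case (Seq c1 c2)
  from Seq.IH(1)[of "wp W c2 Q" s] Seq.prems obtain t1 s1 where
    1: "exec W c1 s t1 s1" "t1 \<le> cost c1" "wp W c2 Q s1"
    by (auto simp: reaches_def)
  from Seq.IH(2)[OF 1(3)] obtain t2 s2 where "exec W c2 s1 t2 s2" "t2 \<le> cost c2" "Q s2"
    by (auto simp: reaches_def)
  with 1 show ?case
    unfolding reaches_def by (intro exI[of _ "t1 + t2"] exI[of _ s2]) (auto intro: exec.Seq)
next
  case (If i c1 c2)
  show ?case
  proof (cases "mem s i > 0")
    case True
    with If.IH(1)[of Q s] If.prems obtain t s' where "exec W c1 s t s'" "t \<le> cost c1" "Q s'"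
      by (auto simp: reaches_def)
    with True show ?thesis
      unfolding reaches_def by (intro exI[of _ "1 + t"] exI[of _ s']) (auto intro!: exec.IfTrue[simplified])
  next
    case False
    with If.IH(2)[of Q s] If.prems obtain t s' where "exec W c2 s t s'" "t \<le> cost c2" "Q s'"
      by (auto simp: reaches_def)
    with False show ?thesis
      unfolding reaches_def by (intro exI[of _ "1 + t"] exI[of _ s']) (auto intro!: exec.IfFalse[simplified])
  qed
next
  case (Read i)
  then obtain x xs where "inp s = x # xs"
    by (cases "inp s") auto
  with Read exec.Read[OF this, of W i] show ?case
    by (auto simp: reaches_def)
qed (force simp: reaches_def intro: exec.intros)+

lemma reaches_Seq:
  assumes "reaches W c1 T1 P s" "\<And>s'. P s' \<Longrightarrow> reaches W c2 T2 Q s'"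
  shows "reaches W (Seq c1 c2) (T1 + T2) Q s"
  using assms unfolding reaches_def by (meson add_mono exec.Seq)

text \<open>The invariant is indexed by the number of iterations that remain, which fits loops that count a
  register down to \<open>0\<close>.\<close>

lemma reaches_While:
  assumes "I N s" "\<And>s. I 0 s \<Longrightarrow> mem s i = 0"
    and "\<And>k s. k < N \<Longrightarrow> I (Suc k) s \<Longrightarrow> mem s i > 0 \<and> wp W c (I k) s"
  shows "reaches W (While i c) (1 + N * (1 + cost c)) (I 0) s"
  using assms(1,3)
proof (induction N arbitrary: s)
  case 0
  have "exec W (While i c) s 1 s"
    by (rule exec.WhileFalse[OF assms(2)[OF 0(1)]])
  with 0(1) show ?case
    unfolding reaches_def by (intro exI[of _ 1] exI[of _ s]) simp
next
  case (Suc N)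
  from Suc.prems have pos: "mem s i > 0" and body: "wp W c (I N) s"
    by auto
  from reaches_wp[OF body] obtain t1 s1 where 1: "exec W c s t1 s1" "t1 \<le> cost c" "I N s1"
    by (auto simp: reaches_def)
  have "reaches W (While i c) (1 + N * (1 + cost c)) (I 0) s1"
    by (rule Suc.IH[OF 1(3)], rule Suc.prems(2)) simp_all
  then obtain t2 s2 where
    2: "exec W (While i c) s1 t2 s2" "t2 \<le> 1 + N * (1 + cost c)" "I 0 s2"
    by (auto simp: reaches_def)
  have "exec W (While i c) s (1 + t1 + t2) s2"
    by (rule exec.WhileTrue[OF pos 1(1) 2(1)])
  then show ?case
    unfolding reaches_def using 1(2) 2(2,3) by (intro exI[of _ "1 + t1 + t2"] exI[of _ s2]) auto
qed

text \<open>All phases have this shape: initialise, loop, continue. With \<open>S\<close> the input size, the crude bounds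
  on the body make each phase cost at most \<open>20 S + (1 + 2 S (1 + 40)) \<le> 103 S\<close>, so that times add up
  phase by phase.\<close>

lemma reaches_loop:
  assumes init: "wp W c0 (I N) s"
    and stop: "\<And>s. I 0 s \<Longrightarrow> mem s i = 0"
    and step: "\<And>k s. I (Suc k) s \<Longrightarrow> mem s i > 0 \<and> wp W c (I k) s"
    and rest: "\<And>s. I 0 s \<Longrightarrow> reaches W c2 (K * S) Q s"
    and bounds: "N \<le> 2 * S" "1 \<le> S" "cost c0 \<le> 20" "cost c \<le> 40"
  shows "reaches W (Seq c0 (Seq (While i c) c2)) ((103 + K) * S) Q s"
proof -
  have loop: "reaches W (While i c) (1 + N * (1 + cost c)) (I 0) s'" if "I N s'" for s'
    by (rule reaches_While[where I = I]) (use that stop step in blast)+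
  have "reaches W (Seq c0 (Seq (While i c) c2)) (cost c0 + (1 + N * (1 + cost c) + K * S)) Q s"
    by (rule reaches_Seq[OF reaches_wp[OF init] reaches_Seq[OF loop rest]])
  moreover have "N * (1 + cost c) \<le> (2 * S) * 41"
    by (rule mult_le_mono) (use bounds in simp_all)
  then have "cost c0 + (1 + N * (1 + cost c) + K * S) \<le> (103 + K) * S"
    using bounds by (simp add: algebra_simps)
  ultimately show ?thesis
    unfolding reaches_def by (meson order_trans)
qed

section \<open>The program\<close>

text \<open>
  The cells below \<open>20\<close> are registers: the number \<open>n\<close> of vertices, twice the number of edges, the
  constants one and zero, the start addresses of the three arrays (see \<open>laid_out\<close>), the loop counter,
  an address, two values, a running maximum (or sum), the vertices \<open>v\<close> and \<open>y\<close>, the best threshold and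
  its value, a flag, and a write pointer that later doubles as the result of a comparison.
  The cells \<open>0\<close> and \<open>1\<close> are left alone, since register names that are numerals \<open>\<ge> 2\<close> are compared
  by simplification without detours through \<open>Suc\<close>.
\<close>

abbreviation (input) "rN \<equiv> 2::nat"
abbreviation (input) "rL \<equiv> 3::nat"
abbreviation (input) "rOne \<equiv> 4::nat"
abbreviation (input) "rZero \<equiv> 5::nat"
abbreviation (input) "rD \<equiv> 6::nat"
abbreviation (input) "rC \<equiv> 7::nat"
abbreviation (input) "rE \<equiv> 8::nat"
abbreviation (input) "rI \<equiv> 9::nat"
abbreviation (input) "rA \<equiv> 10::nat"
abbreviation (input) "rX \<equiv> 11::nat"
abbreviation (input) "rZ \<equiv> 12::nat"
abbreviation (input) "rMax \<equiv> 13::nat"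
abbreviation (input) "rV \<equiv> 14::nat"
abbreviation (input) "rY \<equiv> 15::nat"
abbreviation (input) "rT \<equiv> 16::nat"
abbreviation (input) "rBest \<equiv> 17::nat"
abbreviation (input) "rFlag \<equiv> 18::nat"
abbreviation (input) "rPtr \<equiv> 19::nat"

abbreviation seq (infixr ";;" 60) where "c1 ;; c2 \<equiv> Seq c1 c2"
abbreviation copy where "copy i j \<equiv> Add i j rZero"

definition read_header :: com where
  "read_header = Read rN ;; Read rL ;; Add rL rL rL ;; Const rOne 1 ;; Const rZero 0 ;; Const rD 20 ;;
    Add rC rD rN ;; Add rE rC rN ;; Add rE rE rOne ;; copy rI rL ;; copy rPtr rE"

text \<open>Edges are read one endpoint at a time; the number of occurrences of a vertex among the endpoints
  is its degree.\<close>

definition read_endpoint :: com where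
  "read_endpoint = Read rX ;; Store rPtr rX ;; Add rPtr rPtr rOne ;;
    Add rA rD rX ;; Load rX rA ;; Add rX rX rOne ;; Store rA rX ;; Sub rI rI rOne"

definition update_max :: com where
  "update_max = Sub rI rI rOne ;; Add rA rD rI ;; Load rX rA ;; Sub rZ rX rMax ;;
    If rZ (copy rMax rX ;; copy rV rI) Skip"

text \<open>Runs \<open>act\<close> if the next edge contains the vertex in register \<open>t\<close>, with the other endpoint in
  \<open>rZ\<close>. Equality is tested by \<open>(a - b) + (b - a) = 0\<close> in truncated subtraction.\<close>

definition scan_edge :: "nat \<Rightarrow> com \<Rightarrow> com" where
  "scan_edge t act =
    Sub rI rI rOne ;; Add rA rE rI ;; Load rZ rA ;; Sub rI rI rOne ;; Add rA rE rI ;; Load rX rA ;;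
    Sub rPtr rX t ;; Sub rA t rX ;; Add rPtr rPtr rA ;;
    If rPtr
      (Sub rPtr rZ t ;; Sub rA t rZ ;; Add rPtr rPtr rA ;; If rPtr Skip (copy rZ rX ;; act))
      act"

definition clear_level :: com where
  "clear_level = Add rA rD rZ ;; Store rA rZero"

definition count_level :: com where
  "count_level = Sub rI rI rOne ;; Add rA rD rI ;; Load rA rA ;; Add rA rC rA ;; Load rX rA ;;
    Add rX rX rOne ;; Store rA rX"

text \<open>\<open>rMax\<close> holds the number of vertices of level larger than the threshold \<open>rI\<close>; thresholds are
  tried from \<open>n\<close> downwards.\<close>

definition try_threshold :: com where
  "try_threshold = Add rX rMax rI ;; Sub rZ rBest rX ;; If rZ (copy rT rI ;; copy rBest rX) Skip ;;
    Add rA rC rI ;; Load rX rA ;; Add rMax rMax rX ;; Sub rI rI rOne"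

text \<open>Besides printing, searches for the vertex \<open>y\<close> of largest level not above the threshold.\<close>

definition print_above :: com where
  "print_above = Sub rI rI rOne ;; Add rA rD rI ;; Load rX rA ;; Sub rZ rX rT ;;
    If rZ (Print rI) (Sub rZ rX rMax ;; If rZ (copy rMax rX ;; copy rY rI) Skip)"

text \<open>The flag suppresses the first neighbour of \<open>y\<close>: that one may stay.\<close>

definition print_next :: com where
  "print_next = If rFlag (Print rZ) (copy rFlag rOne)"

text \<open>Each phase contains all later ones as its tail, in the shape required by \<open>reaches_loop\<close>.\<close>

definition print_neighbours :: com where
  "print_neighbours = (copy rI rL ;; Const rFlag 0) ;; While rI (scan_edge rY print_next) ;; Skip"

definition print_above_threshold :: com where
  "print_above_threshold =
    (copy rI rN ;; Const rMax 0 ;; copy rY rN) ;; While rI print_above ;; print_neighbours"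

definition choose_threshold :: com where
  "choose_threshold = (copy rI rN ;; Const rMax 0 ;; copy rT rN ;; copy rBest rN) ;;
    While rI try_threshold ;; print_above_threshold"

definition count_levels :: com where
  "count_levels =
    (Add rA rD rV ;; Store rA rZero ;; copy rI rN) ;; While rI count_level ;; choose_threshold"

definition clear_levels :: com where
  "clear_levels = copy rI rL ;; While rI (scan_edge rV clear_level) ;; count_levels"

definition find_max :: com where
  "find_max = (copy rI rN ;; Const rMax 0 ;; Const rV 0) ;; While rI update_max ;; clear_levels"

definition fvs_program :: com where
  "fvs_program = read_header ;; While rI read_endpoint ;; find_max"

section \<open>Edge lists and their layout in memory\<close>

definition endpoints :: "(nat \<times> nat) list \<Rightarrow> nat list" where
  "endpoints es = concat (map (\<lambda>(u, v). [u, v]) es)"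

fun nbrs :: "nat \<Rightarrow> (nat \<times> nat) list \<Rightarrow> nat list" where
  "nbrs t [] = []"
| "nbrs t ((x, y) # es) = (if x = t then [y] else if y = t then [x] else []) @ nbrs t es"

lemma endpoints_simps [simp]:
  "endpoints [] = []" "endpoints ((u, v) # es) = u # v # endpoints es"
  by (simp_all add: endpoints_def)

lemma length_endpoints [simp]: "length (endpoints es) = 2 * length es"
  by (induction es) auto

lemma endpoints_nth:
  "k < length es \<Longrightarrow> endpoints es ! (2 * k) = fst (es ! k) \<and> endpoints es ! Suc (2 * k) = snd (es ! k)"
proof (induction es arbitrary: k)
  case (Cons e es)
  then show ?case
    by (cases k; cases e) auto
qed simp

lemma count_endpoints:
  "\<forall>(x, y)\<in>set es. x \<noteq> y \<Longrightarrow> count_list (endpoints es) t = length (nbrs t es)"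
  by (induction t es rule: nbrs.induct) auto

lemma nbrs_drop:
  "k < length es \<Longrightarrow> nbrs t (drop k es) = nbrs t [es ! k] @ nbrs t (drop (Suc k) es)"
  by (cases "es ! k") (simp add: Cons_nth_drop_Suc[symmetric])

abbreviation pairs :: "(nat \<times> nat) list \<Rightarrow> nat set list" where
  "pairs \<equiv> map (\<lambda>(u, v). {u, v})"

lemma set_nbrs: "set (nbrs t es) = {w. {t, w} \<in> set (pairs es)}"
proof (induction es)
  case (Cons e es)
  then show ?case
    by (cases e) (auto simp: doubleton_eq_iff simp del: set_map)
qed simp

lemma distinct_nbrs: "distinct (pairs es) \<Longrightarrow> distinct (nbrs t es)"
proof (induction es)
  case (Cons e es)
  then show ?case
    by (cases e) (auto simp: set_nbrs insert_commute)
qed simp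

text \<open>After the registers come an array \<open>D\<close> of \<open>n\<close> cells, indexed by vertices (degrees, then levels),
  an array \<open>C\<close> of \<open>n + 1\<close> cells, indexed by levels, and the endpoints of the edges, of which the first
  \<open>r\<close> have been stored.\<close>

definition laid_out :: "nat \<Rightarrow> nat list \<Rightarrow> nat \<Rightarrow> (nat \<Rightarrow> nat) \<Rightarrow> (nat \<Rightarrow> nat) \<Rightarrow> (nat \<Rightarrow> nat) \<Rightarrow> bool" where
  "laid_out n xs r D C \<mu> \<longleftrightarrow>
    \<mu> rN = n \<and> \<mu> rL = length xs \<and> \<mu> rOne = 1 \<and> \<mu> rZero = 0 \<and>
    \<mu> rD = 20 \<and> \<mu> rC = 20 + n \<and> \<mu> rE = 21 + 2 * n \<and>
    (\<forall>u<n. \<mu> (20 + u) = D u) \<and> (\<forall>d\<le>n. \<mu> (20 + n + d) = C d) \<and>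
    (\<forall>k<r. \<mu> (21 + 2 * n + k) = xs ! k)"

section \<open>The loops\<close>

text \<open>Extends the range covered by an invariant when the counter goes down from \<open>Suc k\<close> to \<open>k\<close>.\<close>

lemma all_ge_Suc:
  fixes n k :: nat
  shows "(\<forall>u<n. k \<le> u \<longrightarrow> P u) \<longleftrightarrow> (k < n \<longrightarrow> P k) \<and> (\<forall>u<n. Suc k \<le> u \<longrightarrow> P u)"
  by (metis Suc_leD Suc_leI antisym_conv2 order_le_less)

locale encoding =
  fixes n :: nat and es :: "(nat \<times> nat) list" and W :: nat
  assumes n_pos: "0 < n"
    and edge_bound: "\<And>x y. (x, y) \<in> set es \<Longrightarrow> x < n \<and> y < n \<and> x \<noteq> y"
    and distinct_edges: "distinct (pairs es)"
    and word_bound: "30 + 4 * n + 4 * length es \<le> W"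
begin

abbreviation "L \<equiv> endpoints es"

lemma endpoint_less: "k < 2 * length es \<Longrightarrow> L ! k < n"
proof -
  assume "k < 2 * length es"
  then have "L ! k \<in> set L"
    by simp
  then show ?thesis
    using edge_bound by (auto simp: endpoints_def)
qed

definition reading :: "nat \<Rightarrow> state \<Rightarrow> bool" where
  "reading k s \<longleftrightarrow> (\<exists>i. i + k = length L \<and>
    laid_out n L i (count_list (take i L)) (\<lambda>_. 0) (mem s) \<and>
    mem s rI = k \<and> mem s rPtr = 21 + 2 * n + i \<and> inp s = drop i L \<and> out s = [])"

lemma read_header:
  "wp W read_header (reading (length L)) (initial_state (n # length es # L))"
  using word_bound
  by (auto simp: read_header_def initial_state_def reading_def laid_out_def)

lemma read_endpoint:
  assumes s: "reading (Suc k) s"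
  shows "mem s rI > 0 \<and> wp W read_endpoint (reading k) s"
proof -
  obtain i where i: "Suc i + k = length L"
    and s: "laid_out n L i (count_list (take i L)) (\<lambda>_. 0) (mem s)"
    "mem s rI = Suc k" "mem s rPtr = 21 + 2 * n + i" "inp s = drop i L" "out s = []"
    using s by (auto simp: reading_def)
  have len: "i < length L"
    using i by simp
  have "L ! i < n"
    using endpoint_less i by simp
  moreover have "count_list (take i L) (L ! i) \<le> i"
    using count_le_length[of "take i L"] len by (metis length_take less_imp_le_nat min.absorb2)
  moreover have "take (Suc i) L = take i L @ [L ! i]" "drop i L = L ! i # drop (Suc i) L"
    using len by (simp_all add: take_Suc_conv_app_nth Cons_nth_drop_Suc)
  ultimately show ?thesis
    using s word_bound i unfolding reading_def
    by (auto simp: laid_out_def read_endpoint_def less_Suc_eq intro!: exI[of _ "Suc i"])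
qed

abbreviation "D \<equiv> count_list L"

lemma D_eq: "D u = length (nbrs u es)"
  by (rule count_endpoints) (use edge_bound in blast)

lemma nbrs_less: "w \<in> set (nbrs t es) \<Longrightarrow> w < n"
  using edge_bound by (fastforce simp: set_nbrs doubleton_eq_iff)

lemma D_le: "D u \<le> n"
proof -
  have "length (nbrs u es) = card (set (nbrs u es))"
    using distinct_nbrs[OF distinct_edges] by (simp add: distinct_card)
  also have "\<dots> \<le> card {..<n}"
    by (rule card_mono) (auto dest: nbrs_less)
  finally show ?thesis
    by (simp add: D_eq)
qed

abbreviation loaded :: "(nat \<Rightarrow> nat) \<Rightarrow> (nat \<Rightarrow> nat) \<Rightarrow> state \<Rightarrow> bool" where
  "loaded X C s \<equiv> laid_out n L (length L) X C (mem s)"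

text \<open>\<open>rMax\<close> is only bounded by the degree of the candidate: initially the candidate is \<open>0\<close> and \<open>rMax\<close>
  is \<open>0\<close>, whatever the degree of vertex \<open>0\<close>.\<close>

definition maxing :: "nat \<Rightarrow> state \<Rightarrow> bool" where
  "maxing k s \<longleftrightarrow> k \<le> n \<and> loaded D (\<lambda>_. 0) s \<and> mem s rI = k \<and> out s = [] \<and>
    mem s rV < n \<and> mem s rMax \<le> D (mem s rV) \<and> (\<forall>u<n. k \<le> u \<longrightarrow> D u \<le> mem s rMax)"

lemma update_max:
  assumes "maxing (Suc k) s"
  shows "mem s rI > 0 \<and> wp W update_max (maxing k) s"
  using assms word_bound D_le[of k]
  by (auto simp: maxing_def laid_out_def update_max_def all_ge_Suc[of n k])

text \<open>The memory after fetching and comparing is described only up to the scratch registers, so that the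
  two loops over the edges need not know how \<open>scan_edge\<close> works.\<close>

lemma scan_edge:
  assumes s: "loaded X C s" "mem s rI = 2 * Suc k" "k < length es"
    and t: "t \<in> {rV, rY}" "mem s t \<le> n"
    and none: "\<And>\<mu>. nbrs (mem s t) [es ! k] = [] \<Longrightarrow> \<forall>a. a \<notin> {rI, rA, rX, rZ, rPtr} \<longrightarrow> \<mu> a = mem s a
      \<Longrightarrow> \<mu> rI = 2 * k \<Longrightarrow> Q (s\<lparr>mem := \<mu>\<rparr>)"
    and one: "\<And>\<mu> z. nbrs (mem s t) [es ! k] = [z] \<Longrightarrow> z < n \<Longrightarrow>
      \<forall>a. a \<notin> {rI, rA, rX, rZ, rPtr} \<longrightarrow> \<mu> a = mem s a \<Longrightarrow> \<mu> rI = 2 * k \<Longrightarrow> \<mu> rZ = z \<Longrightarrow>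
      wp W act Q (s\<lparr>mem := \<mu>\<rparr>)"
  shows "wp W (scan_edge t act) Q s"
proof -
  obtain x y where e: "es ! k = (x, y)"
    by (cases "es ! k")
  then have xy: "x < n" "y < n" "x \<noteq> y"
    using edge_bound nth_mem[OF s(3)] by auto
  have L: "L ! (2 * k) = x" "L ! Suc (2 * k) = y"
    using endpoints_nth[OF s(3)] e by auto
  have cell: "mem s (21 + 2 * n + j) = L ! j" if "j < length L" for j
    using s(1) that by (simp add: laid_out_def)
  \<comment> \<open>With a variable for the address, these rewrite however the simplifier arranges the sum.\<close>
  have E: "a = 21 + 2 * n + 2 * k \<Longrightarrow> mem s a = x" "a = 22 + 2 * n + 2 * k \<Longrightarrow> mem s a = y" for a
    using cell[of "2 * k"] cell[of "Suc (2 * k)"] s(3) L by (simp_all add: add.assoc)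
  have regs: "mem s rOne = 1" "mem s rZero = 0" "mem s rE = 21 + 2 * n"
    using s by (auto simp: laid_out_def)
  obtain \<tau> where \<tau>: "mem s t = \<tau>"
    by blast
  note facts = t(2)[unfolded \<tau>] \<tau> regs s(2,3) xy word_bound
  have diff: "z - \<tau> + (\<tau> - z) \<le> W" if "z < n" for z
    using that t(2) word_bound unfolding \<tau> by linarith
  consider (fst) "x = \<tau>" | (snd) "x \<noteq> \<tau>" "y = \<tau>" | (no) "x \<noteq> \<tau>" "y \<noteq> \<tau>"
    by blast
  then show ?thesis
  proof cases
    case fst
    show ?thesis
      by (insert t(1) facts fst E; elim insertE emptyE;
          simp add: scan_edge_def add.assoc; rule one[of y]; simp add: e add.assoc)
  next
    case snd
    then have ne: "\<tau> < x \<or> x < \<tau>" "x < \<tau> \<or> \<tau> < x"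
      by auto
    show ?thesis
      by (insert t(1) facts snd diff[OF xy(1)] ne E; elim insertE emptyE;
          simp add: scan_edge_def add.assoc; rule one[of x]; simp add: e add.assoc)
  next
    case no
    then have ne: "\<tau> < x \<or> x < \<tau>" "x < \<tau> \<or> \<tau> < x" "\<tau> < y \<or> y < \<tau>" "y < \<tau> \<or> \<tau> < y"
      by auto
    show ?thesis
      by (insert t(1) facts no diff[OF xy(1)] diff[OF xy(2)] ne E; elim insertE emptyE;
          simp add: scan_edge_def add.assoc; rule none; simp add: e add.assoc)
  qed
qed

text \<open>The edges are scanned from the last to the first, so those already seen form a suffix of the
  list.\<close>

definition clearing :: "nat \<Rightarrow> nat \<Rightarrow> state \<Rightarrow> bool" where
  "clearing v k s \<longleftrightarrow> k \<le> length es \<and> v < n \<and>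
    loaded (\<lambda>u. if u \<in> set (nbrs v (drop k es)) then 0 else D u) (\<lambda>_. 0) s \<and>
    mem s rI = 2 * k \<and> mem s rV = v \<and> out s = []"

lemma clear_edge:
  assumes "clearing v (Suc k) s"
  shows "mem s rI > 0 \<and> wp W (scan_edge rV clear_level) (clearing v k) s"
proof
  show "mem s rI > 0"
    using assms by (simp add: clearing_def)
  have k: "k < length es"
    using assms by (simp add: clearing_def)
  note drop = nbrs_drop[OF k, of v]
  show "wp W (scan_edge rV clear_level) (clearing v k) s"
  proof (rule scan_edge)
    show "loaded (\<lambda>u. if u \<in> set (nbrs v (drop (Suc k) es)) then 0 else D u) (\<lambda>_. 0) s"
      "mem s rI = 2 * Suc k" "k < length es" "rV \<in> {rV, rY}" "mem s rV \<le> n"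
      using assms by (auto simp: clearing_def)
  next
    fix \<mu> assume "nbrs (mem s rV) [es ! k] = []" "\<forall>a. a \<notin> {rI, rA, rX, rZ, rPtr} \<longrightarrow> \<mu> a = mem s a"
      "\<mu> rI = 2 * k"
    then show "clearing v k (s\<lparr>mem := \<mu>\<rparr>)"
      using assms drop by (auto simp: clearing_def laid_out_def)
  next
    fix \<mu> z assume "nbrs (mem s rV) [es ! k] = [z]" "z < n"
      "\<forall>a. a \<notin> {rI, rA, rX, rZ, rPtr} \<longrightarrow> \<mu> a = mem s a" "\<mu> rI = 2 * k" "\<mu> rZ = z"
    then show "wp W clear_level (clearing v k) (s\<lparr>mem := \<mu>\<rparr>)"
      using assms drop word_bound by (auto simp: clearing_def laid_out_def clear_level_def)
  qed
qed

definition stored_level :: "nat \<Rightarrow> nat \<Rightarrow> nat" where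
  "stored_level v u = (if u = v \<or> u \<in> set (nbrs v es) then 0 else D u)"

lemma stored_level_le: "stored_level v u \<le> n"
  using D_le by (simp add: stored_level_def)

definition counting :: "nat \<Rightarrow> nat \<Rightarrow> state \<Rightarrow> bool" where
  "counting v k s \<longleftrightarrow> k \<le> n \<and>
    loaded (stored_level v) (\<lambda>d. card {u. k \<le> u \<and> u < n \<and> stored_level v u = d}) s \<and> mem s rI = k \<and> out s = []"

lemma count_level:
  assumes "counting v (Suc k) s"
  shows "mem s rI > 0 \<and> wp W count_level (counting v k) s"
proof -
  have k: "k < n"
    using assms by (simp add: counting_def)
  have "{u. k \<le> u \<and> u < n \<and> stored_level v u = d} =
      (if d = stored_level v k then insert k {u. Suc k \<le> u \<and> u < n \<and> stored_level v u = d}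
       else {u. Suc k \<le> u \<and> u < n \<and> stored_level v u = d})" for d
    using k by (auto simp: Suc_le_eq le_less)
  then have card: "card {u. k \<le> u \<and> u < n \<and> stored_level v u = d} =
      card {u. Suc k \<le> u \<and> u < n \<and> stored_level v u = d} + (if d = stored_level v k then 1 else 0)" for d
    by simp
  have "card {u. Suc k \<le> u \<and> u < n \<and> stored_level v u = stored_level v k} \<le> card {..<n}"
    by (rule card_mono) auto
  then show ?thesis
    using assms word_bound k stored_level_le[of v k]
    by (auto simp: counting_def laid_out_def count_level_def card)
qed

definition above_count :: "nat \<Rightarrow> nat \<Rightarrow> nat" where
  "above_count v d = card {u. u < n \<and> d < stored_level v u}"

lemma above_count_le: "above_count v d \<le> n"
  using card_mono[of "{..<n}" "{u. u < n \<and> d < stored_level v u}"] by (auto simp: above_count_def)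

lemma above_count_n: "above_count v n = 0"
  using stored_level_le by (simp add: above_count_def not_less)

lemma above_count_Suc: "above_count v k =
    above_count v (Suc k) + card {u. u < n \<and> stored_level v u = Suc k}"
proof -
  have "{u. u < n \<and> k < stored_level v u} = {u. u < n \<and> Suc k < stored_level v u} \<union>
      {u. u < n \<and> stored_level v u = Suc k}"
    by auto
  then show ?thesis
    unfolding above_count_def by (simp add: card_Un_disjoint disjoint_iff)
qed

definition thresholding :: "nat \<Rightarrow> nat \<Rightarrow> state \<Rightarrow> bool" where
  "thresholding v k s \<longleftrightarrow> k \<le> n \<and>
    loaded (stored_level v) (\<lambda>d. card {u. u < n \<and> stored_level v u = d}) s \<and> mem s rI = k \<and> out s = [] \<and>
    mem s rMax = above_count v k \<and> 1 \<le> mem s rT \<and> mem s rT \<le> n \<and>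
    mem s rBest = above_count v (mem s rT) + mem s rT \<and>
    (\<forall>d\<le>n. Suc k \<le> d \<longrightarrow> mem s rBest \<le> above_count v d + d)"

lemma try_threshold:
  assumes "thresholding v (Suc k) s"
  shows "mem s rI > 0 \<and> wp W try_threshold (thresholding v k) s"
proof -
  have "(\<forall>d\<le>n. Suc k \<le> d \<longrightarrow> P d) \<longleftrightarrow> (Suc k \<le> n \<longrightarrow> P (Suc k)) \<and> (\<forall>d\<le>n. Suc (Suc k) \<le> d \<longrightarrow> P d)" for P
    using all_ge_Suc[of "Suc n" "Suc k" P] by (auto simp: less_Suc_eq_le)
  then show ?thesis
    using assms word_bound above_count_le[of v "Suc k"] above_count_Suc[of v k] above_count_le[of v k]
    by (auto simp: thresholding_def laid_out_def try_threshold_def)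
qed

text \<open>\<open>rY = n\<close>, which is not a vertex, stands for the absence of a candidate.\<close>

definition printing :: "nat \<Rightarrow> nat \<Rightarrow> nat \<Rightarrow> state \<Rightarrow> bool" where
  "printing v d k s \<longleftrightarrow> k \<le> n \<and> loaded (stored_level v) (\<lambda>d. card {u. u < n \<and> stored_level v u = d}) s \<and>
    mem s rI = k \<and> mem s rT = d \<and> out s = rev (filter (\<lambda>u. d < stored_level v u) [k..<n]) \<and>
    mem s rMax \<le> d \<and> (\<forall>u<n. k \<le> u \<longrightarrow> stored_level v u \<le> d \<longrightarrow> stored_level v u \<le> mem s rMax) \<and>
    (if mem s rMax = 0 then mem s rY = n else mem s rY < n \<and> stored_level v (mem s rY) = mem s rMax)"

lemma print_above:
  assumes "printing v d (Suc k) s"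
  shows "mem s rI > 0 \<and> wp W print_above (printing v d k) s"
  using assms word_bound stored_level_le[of v k]
  by (auto simp: printing_def laid_out_def print_above_def all_ge_Suc[of n k] upt_conv_Cons)

text \<open>The neighbours of \<open>y\<close> appear in reverse order of the edge list, and the first to appear is
  dropped.\<close>

definition finishing :: "nat \<Rightarrow> nat list \<Rightarrow> nat \<Rightarrow> state \<Rightarrow> bool" where
  "finishing y xs k s \<longleftrightarrow> k \<le> length es \<and> y \<le> n \<and> (\<exists>X C. loaded X C s) \<and>
    mem s rI = 2 * k \<and> mem s rY = y \<and> (mem s rFlag = 0 \<longleftrightarrow> nbrs y (drop k es) = []) \<and>
    out s = xs @ tl (rev (nbrs y (drop k es)))"

lemma print_edge:
  assumes "finishing y xs (Suc k) s"
  shows "mem s rI > 0 \<and> wp W (scan_edge rY print_next) (finishing y xs k) s"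
proof
  show "mem s rI > 0"
    using assms by (simp add: finishing_def)
  have k: "k < length es"
    using assms by (simp add: finishing_def)
  note drop = nbrs_drop[OF k, of y]
  obtain X C where XC: "loaded X C s"
    using assms by (auto simp: finishing_def)
  show "wp W (scan_edge rY print_next) (finishing y xs k) s"
  proof (rule scan_edge[OF XC])
    show "mem s rI = 2 * Suc k" "k < length es" "rY \<in> {rV, rY}" "mem s rY \<le> n"
      using assms by (auto simp: finishing_def)
  next
    fix \<mu> assume \<mu>: "nbrs (mem s rY) [es ! k] = []"
      "\<forall>a. a \<notin> {rI, rA, rX, rZ, rPtr} \<longrightarrow> \<mu> a = mem s a" "\<mu> rI = 2 * k"
    then have "loaded X C (s\<lparr>mem := \<mu>\<rparr>)"
      using XC by (auto simp: laid_out_def)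
    with \<mu> show "finishing y xs k (s\<lparr>mem := \<mu>\<rparr>)"
      using assms drop by (auto simp: finishing_def)
  next
    fix \<mu> z assume \<mu>: "nbrs (mem s rY) [es ! k] = [z]" "z < n"
      "\<forall>a. a \<notin> {rI, rA, rX, rZ, rPtr} \<longrightarrow> \<mu> a = mem s a" "\<mu> rI = 2 * k" "\<mu> rZ = z"
    then have 1: "loaded X C (s\<lparr>mem := \<mu>\<rparr>)" "loaded X C (s\<lparr>mem := \<mu>(rFlag := 1)\<rparr>)"
      and 2: "\<mu> rOne = 1" "\<mu> rZero = 0"
      using XC by (auto simp: laid_out_def)
    then show "wp W print_next (finishing y xs k) (s\<lparr>mem := \<mu>\<rparr>)"
      using \<mu> assms drop word_bound
      by (auto simp: finishing_def print_next_def tl_append split: list.split)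
  qed
qed

section \<open>The whole program\<close>

abbreviation "S \<equiv> n + length es"

lemma S_pos: "1 \<le> S"
  using n_pos by simp

lemmas cost_defs = read_header_def read_endpoint_def update_max_def scan_edge_def clear_level_def
  count_level_def try_threshold_def print_above_def print_next_def

lemma print_neighbours:
  assumes "printing v d 0 s"
  shows "reaches W print_neighbours (104 * S)
    (\<lambda>s'. out s' = out s @ tl (rev (nbrs (mem s rY) es))) s"
proof -
  have y: "mem s rY \<le> n"
    using assms by (auto simp: printing_def split: if_splits)
  have "reaches W print_neighbours ((103 + 1) * S)
    (\<lambda>s'. out s' = out s @ tl (rev (nbrs (mem s rY) es))) s"
    unfolding print_neighbours_def
  proof (rule reaches_loop[where I = "finishing (mem s rY) (out s)" and N = "length es"])
    show "wp W (copy rI rL ;; Const rFlag 0) (finishing (mem s rY) (out s) (length es)) s"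
      using assms y word_bound by (auto simp: printing_def finishing_def laid_out_def)
    fix s' assume "finishing (mem s rY) (out s) 0 s'"
    then have "wp W Skip (\<lambda>s'. out s' = out s @ tl (rev (nbrs (mem s rY) es))) s'"
      by (simp add: finishing_def)
    from reaches_wp[OF this] show "reaches W Skip (1 * S)
      (\<lambda>s'. out s' = out s @ tl (rev (nbrs (mem s rY) es))) s'"
      using S_pos unfolding reaches_def by fastforce
  qed (simp add: finishing_def, erule print_edge,
      use S_pos in \<open>simp_all add: cost_defs\<close>)
  then show ?thesis
    by simp
qed

definition chosen :: "nat \<Rightarrow> nat \<Rightarrow> nat \<Rightarrow> bool" where
  "chosen v d y \<longleftrightarrow> 1 \<le> d \<and> d \<le> n \<and> (\<forall>d'\<le>n. 1 \<le> d' \<longrightarrow> above_count v d + d \<le> above_count v d' + d') \<and>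
    (y = n \<and> (\<forall>u<n. stored_level v u \<le> d \<longrightarrow> stored_level v u = 0) \<or>
     y < n \<and> 0 < stored_level v y \<and> stored_level v y \<le> d \<and>
     (\<forall>u<n. stored_level v u \<le> d \<longrightarrow> stored_level v u \<le> stored_level v y))"

definition printed :: "nat \<Rightarrow> nat \<Rightarrow> nat \<Rightarrow> nat list" where
  "printed v d y = rev (filter (\<lambda>u. d < stored_level v u) [0..<n]) @ tl (rev (nbrs y es))"

abbreviation result :: "nat \<Rightarrow> state \<Rightarrow> bool" where
  "result v s \<equiv> \<exists>d y. chosen v d y \<and> out s = printed v d y"

lemma print_above_threshold:
  assumes "thresholding v 0 s"
  shows "reaches W print_above_threshold (207 * S) (result v) s"
proof -
  have "reaches W print_above_threshold ((103 + 104) * S) (result v) s"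
    unfolding print_above_threshold_def
  proof (rule reaches_loop[where I = "printing v (mem s rT)" and N = n])
    show "wp W (copy rI rN ;; Const rMax 0 ;; copy rY rN) (printing v (mem s rT) n) s"
      using assms word_bound by (auto simp: thresholding_def printing_def laid_out_def)
    fix s' assume s': "printing v (mem s rT) 0 s'"
    have "chosen v (mem s rT) (mem s' rY)"
      using s' assms by (auto simp: chosen_def printing_def thresholding_def split: if_splits)
    moreover have "out s' @ tl (rev (nbrs (mem s' rY) es)) = printed v (mem s rT) (mem s' rY)"
      using s' by (simp add: printing_def printed_def)
    ultimately show "reaches W print_neighbours (104 * S) (result v) s'"
      using print_neighbours[OF s'] unfolding reaches_def by metis
  qed (simp add: printing_def, erule print_above,
      use S_pos in \<open>simp_all add: cost_defs\<close>)
  then show ?thesis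
    by simp
qed

lemma choose_threshold:
  assumes "counting v 0 s"
  shows "reaches W choose_threshold (310 * S) (result v) s"
proof -
  have "reaches W choose_threshold ((103 + 207) * S) (result v) s"
    unfolding choose_threshold_def
  proof (rule reaches_loop[where I = "thresholding v" and N = n])
    show "wp W (copy rI rN ;; Const rMax 0 ;; copy rT rN ;; copy rBest rN) (thresholding v n) s"
      using assms word_bound n_pos above_count_n[of v]
      by (auto simp: counting_def thresholding_def laid_out_def)
  qed (simp add: thresholding_def, erule try_threshold, erule print_above_threshold,
      use S_pos in \<open>simp_all add: cost_defs\<close>)
  then show ?thesis
    by simp
qed

lemma count_levels:
  assumes "clearing v 0 s"
  shows "reaches W count_levels (413 * S) (result v) s"
proof -
  have "reaches W count_levels ((103 + 310) * S) (result v) s"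
    unfolding count_levels_def
  proof (rule reaches_loop[where I = "counting v" and N = n])
    show "wp W (Add rA rD rV ;; Store rA rZero ;; copy rI rN) (counting v n) s"
      using assms word_bound by (auto simp: clearing_def counting_def laid_out_def stored_level_def)
  qed (simp add: counting_def, erule count_level, erule choose_threshold,
      use S_pos in \<open>simp_all add: cost_defs\<close>)
  then show ?thesis
    by simp
qed

abbreviation full_result :: "state \<Rightarrow> bool" where
  "full_result s \<equiv> \<exists>v d y. v < n \<and> (\<forall>u<n. D u \<le> D v) \<and> chosen v d y \<and> out s = printed v d y"

lemma clear_levels:
  assumes "maxing 0 s"
  shows "reaches W clear_levels (516 * S) full_result s"
proof -
  let ?v = "mem s rV"
  have v: "?v < n" "\<forall>u<n. D u \<le> D ?v"
    using assms unfolding maxing_def by (blast, meson le0 order_trans)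
  have "reaches W clear_levels ((103 + 413) * S) full_result s"
    unfolding clear_levels_def
  proof (rule reaches_loop[where I = "clearing ?v" and N = "length es"])
    show "wp W (copy rI rL) (clearing ?v (length es)) s"
      using assms word_bound by (auto simp: maxing_def clearing_def laid_out_def)
    fix s' assume "clearing ?v 0 s'"
    from count_levels[OF this] v show "reaches W count_levels (413 * S) full_result s'"
      unfolding reaches_def by blast
  qed (simp add: clearing_def, erule clear_edge,
      use S_pos in \<open>simp_all add: cost_defs\<close>)
  then show ?thesis
    by simp
qed

lemma find_max:
  assumes "reading 0 s"
  shows "reaches W find_max (619 * S) full_result s"
proof -
  have "reaches W find_max ((103 + 516) * S) full_result s"
    unfolding find_max_def
  proof (rule reaches_loop[where I = maxing and N = n])
    show "wp W (copy rI rN ;; Const rMax 0 ;; Const rV 0) (maxing n) s"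
      using assms word_bound n_pos by (auto simp: reading_def maxing_def laid_out_def)
  qed (simp add: maxing_def, erule update_max, erule clear_levels,
      use S_pos in \<open>simp_all add: cost_defs\<close>)
  then show ?thesis
    by simp
qed

lemma fvs_program:
  "reaches W fvs_program (722 * S) full_result (initial_state (n # length es # L))"
proof -
  have "reaches W fvs_program ((103 + 619) * S) full_result (initial_state (n # length es # L))"
    unfolding fvs_program_def
  proof (rule reaches_loop[where I = reading and N = "length L"])
    show "wp W read_header (reading (length L)) (initial_state (n # length es # L))"
      by (rule read_header)
  qed (simp add: reading_def, erule read_endpoint, erule find_max,
      use S_pos in \<open>simp_all add: cost_defs\<close>)
  then show ?thesis
    by simp
qed

end

section \<open>Minimum feedback vertex sets in linear time\<close>

theorem mainTheorem7:
  shows "\<exists>P. solves_in_linear_time P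
    (\<lambda>G. simple_graph G \<and> connected_graph G \<and> induced_free two_K2 G \<and>
         induced_free (cycle_graph 3) G \<and> induced_free (cycle_graph 5) G)
    minimum_feedback_vertex_set"
proof -
  have "\<exists>t s. exec ((input_size G + 1) ^ 6) fvs_program (initial_state xs) t s \<and>
      t \<le> 722 * input_size G \<and> distinct (out s) \<and> minimum_feedback_vertex_set G (set (out s))"
    if simple: "simple_graph G" and conn: "connected_graph G" and free: "induced_free two_K2 G"
      "induced_free (cycle_graph 3) G" "induced_free (cycle_graph 5) G" and enc: "encodes xs G"
    for G xs
  proof -
    obtain n es where G: "verts G = {..<n}" "edges G = set (pairs es)" "distinct (pairs es)"
      and xs: "xs = n # length es # endpoints es"
      using enc unfolding encodes_def endpoints_def by blast
    have size: "input_size G = n + length es"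
      using G distinct_card[OF G(3)] by (simp add: input_size_def del: set_map)
    have n: "0 < n"
      using conn G(1) by (auto simp: connected_graph_def)
    have bound: "x < n \<and> y < n \<and> x \<noteq> y" if "(x, y) \<in> set es" for x y
    proof -
      have "{x, y} \<in> edges G"
        using that unfolding G(2) by force
      then show ?thesis
        using simple G(1) by (auto simp: simple_graph_def card_insert_if split: if_splits)
    qed
    let ?W = "(input_size G + 1) ^ 6"
    \<comment> \<open>The input size is positive, so its successor is at least \<open>2\<close> and five factors of it suffice
      for the constant \<open>32\<close>.\<close>
    have "30 + 4 * n + 4 * length es \<le> 32 * (input_size G + 1)"
      unfolding size by simp
    also have "\<dots> \<le> (input_size G + 1) ^ 5 * (input_size G + 1)"
      using power_mono[of 2 "input_size G + 1" 5] n size by (intro mult_le_mono1) simp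
    also have "\<dots> = ?W"
      by (simp add: eval_nat_numeral)
    finally interpret enc: encoding n es ?W
      using n bound G(3) by unfold_locales auto
    have nb: "nb G u = set (nbrs u es)" for u
      by (simp add: nb_def set_nbrs G(2) del: set_map)
    have D: "enc.D u = card (nb G u)" for u
      using distinct_nbrs[OF G(3)] by (simp add: enc.D_eq nb distinct_card)
    obtain t s v d y where run: "exec ?W fvs_program (initial_state xs) t s" "t \<le> 722 * input_size G"
      and v: "v < n" "\<forall>u<n. enc.D u \<le> enc.D v" and dy: "enc.chosen v d y"
      and out: "out s = enc.printed v d y"
      using enc.fvs_program unfolding xs size reaches_def by blast
    interpret chain: chain_graph G v
      using simple free v by unfold_locales (auto simp: G(1) D)
    have level: "enc.stored_level v u = chain.level u" for u
      by (simp add: enc.stored_level_def chain.level_def nb D)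
    have above: "enc.above_count v d' = card (chain.above d')" for d'
      by (simp add: enc.above_count_def level G(1))
    have d: "1 \<le> d" "d' \<le> n \<Longrightarrow> 1 \<le> d' \<Longrightarrow> card (chain.above d) + d \<le> card (chain.above d') + d'" for d'
      using dy by (simp_all add: enc.chosen_def above)
    let ?hi = "rev (filter (\<lambda>u. d < chain.level u) [0..<n])" and ?nb = "rev (nbrs y es)"
    have out_eq: "out s = ?hi @ tl ?nb"
      by (simp add: out enc.printed_def level)
    have hi: "set ?hi = chain.above d"
      by (auto simp: G(1))
    have y: "y = n \<and> (\<forall>u<n. chain.level u \<le> d \<longrightarrow> chain.level u = 0) \<or>
        y < n \<and> 0 < chain.level y \<and> chain.level y \<le> d \<and>
        (\<forall>u<n. chain.level u \<le> d \<longrightarrow> chain.level u \<le> chain.level y)"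
      using dy by (simp add: enc.chosen_def level)
    have y_cases: "nb G y = {} \<or> y \<in> chain.A \<and> chain.level y = card (nb G y) \<and> card (nb G y) \<le> d"
    proof (cases "y = n")
      case True
      then show ?thesis
        using nb_verts[OF simple] G(1) by blast
    next
      case False
      with y have "y < n" "0 < chain.level y" "chain.level y \<le> d"
        by auto
      then show ?thesis
        by (auto simp: chain.level_def chain.A_def G(1) split: if_splits)
    qed
    have len: "length ?nb = card (nb G y)" and dist: "distinct ?nb"
      using distinct_nbrs[OF G(3), of y] by (simp_all add: nb distinct_card)
    have tl: "set (tl ?nb) \<subseteq> nb G y"
      unfolding nb by (metis list.set_sel(2) list.sel(2) set_rev subsetI)
    have low: "chain.level w = 0" if "w \<in> nb G y" for w
      using y_cases that chain.nb_A[of y] by (auto simp: chain.level_def)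
    have "set ?hi \<inter> set (tl ?nb) = {}"
      unfolding hi using tl low by fastforce
    then have "distinct (out s)"
      unfolding out_eq using dist by (simp add: distinct_tl)
    moreover have "minimum_feedback_vertex_set G (set (out s))"
    proof (rule chain.minimum_feedback_vertex_set_above)
      show "set (out s) \<subseteq> verts G"
        using tl hi nb_verts[OF simple] unfolding out_eq by fastforce
      show "chain.above d \<subseteq> set (out s)"
        unfolding out_eq set_append hi by blast
      show "nb G y \<subseteq> insert (hd ?nb) (set (out s))"
      proof -
        have "set ?nb \<subseteq> insert (hd ?nb) (set (tl ?nb))"
          by (cases ?nb) simp_all
        then show ?thesis
          unfolding out_eq nb by auto
      qed
      show "card (set (out s)) + 1 \<le> card (chain.above d) + d"
      proof -
        have "card (set (out s)) \<le> card (chain.above d) + card (set (tl ?nb))"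
          unfolding out_eq set_append hi by (rule card_Un_le)
        moreover have "card (set (tl ?nb)) = card (nb G y) - 1"
          using dist len by (simp add: distinct_card distinct_tl)
        ultimately show ?thesis
          using y_cases d(1) by auto
      qed
      show "y \<in> chain.A \<and> chain.level u \<le> card (nb G y)"
        if "u \<in> verts G" "0 < chain.level u" "chain.level u \<le> d" for u
        using that y y_cases G(1) by (auto simp: chain.level_def split: if_splits)
      show "card (chain.above d) + d \<le> card (chain.above d') + d'"
        if "1 \<le> d'" "d' \<le> card (verts G)" for d'
        using d that by (simp add: G(1))
    qed
    ultimately show ?thesis
      using run by blast
  qed
  then show ?thesis
    unfolding solves_in_linear_time_def by blast
qed

end
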